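(* Let $a<b$ be real numbers and let $f:[a,b]\to\mathbb{R}$ be differentiable on $[a,b]$ with $f'\in L^\infty[a,b]$. Then for every $p\in\,]a,b[$, $$\left|f(p)-\frac{1}{b-a}\int_a^b f(t)\,dt\right|\le \min\left\{\left[\frac14+\left(\frac{p-\frac{a+b}{2}}{b-a}\right)^2\right](b-a)\,\|f'\|_a^b\;,\;\; \frac12\max\left\{(p-a)\,\|f'\|_a^p\,,\;(b-p)\,\|f'\|_p^b\right\}\right\}.$$
   Context: For $c<d$ in $[a,b]$, $\|f'\|_c^d$ denotes the supremum of $|f'(t)|$ over $t\in[c,d]$. $]a,b[$ denotes the open interval. *)

theory Defs
  imports "HOL-Analysis.Analysis"
begin

text \<open>Membership of a function in \<open>L\<^sup>\<infinity>[a,b]\<close>: Lebesgue measurable and essentially bounded.\<close>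

definition L_infinity_on :: "real \<Rightarrow> real \<Rightarrow> (real \<Rightarrow> real) \<Rightarrow> bool" where
  "L_infinity_on a b g \<longleftrightarrow>
     g \<in> borel_measurable (lebesgue_on {a..b}) \<and>
     (\<exists>C. AE t in lebesgue_on {a..b}. \<bar>g t\<bar> \<le> C)"

text \<open>The true (not essential) supremum of \<open>\<bar>g\<bar>\<close> over \<open>[c,d]\<close>. The real-valued \<open>SUP\<close> is
  unspecified for unbounded \<open>g\<close>. This does not occur when \<open>g\<close> is the derivative, existing
  everywhere on an interval, of some function and \<open>g\<close> is essentially bounded there: the
  primitive is then Lipschitz, so \<open>g\<close> is bounded everywhere.\<close>

definition sup_norm_on :: "real \<Rightarrow> real \<Rightarrow> (real \<Rightarrow> real) \<Rightarrow> real" where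
  "sup_norm_on c d g = (SUP t\<in>{c..d}. \<bar>g t\<bar>)"

end

theory Submission
  imports Defs
begin

text \<open>Since \<open>f\<close> is differentiable at every point, the Henstock--Kurzweil fundamental theorem gives
  \<open>f y - f x = \<integral>\<^bsub>x\<^esub>\<^bsup>y\<^esup> f'\<close> without further hypotheses; an essential bound of \<open>f'\<close> therefore is a
  Lipschitz constant of \<open>f\<close>, hence bounds \<open>f'\<close> everywhere, so that all the suprema are genuine.
  With \<open>A\<close> and \<open>B\<close> the suprema of \<open>\<bar>f'\<bar>\<close> on \<open>[a,p]\<close> and \<open>[p,b]\<close>, integrating
  \<open>\<bar>f p - f t\<bar> \<le> A (p - t)\<close> and \<open>\<bar>f p - f t\<bar> \<le> B (t - p)\<close> gives
  \<open>\<bar>(b - a) f p - \<integral> f\<bar> \<le> ((p - a)\<^sup>2 A + (b - p)\<^sup>2 B) / 2\<close>.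
  Bounding \<open>A\<close> and \<open>B\<close> by the supremum on \<open>[a,b]\<close> yields the first estimate; reading the right-hand
  side, divided by \<open>b - a\<close>, as half a convex combination of \<open>(p - a) A\<close> and \<open>(b - p) B\<close> with weights
  \<open>(p - a) / (b - a)\<close> and \<open>(b - p) / (b - a)\<close> yields the second.\<close>

lemma lipschitz_of_derivative_bounded_off_negligible:
  fixes f f' :: "real \<Rightarrow> real"
  assumes "\<And>x. x \<in> {c..d} \<Longrightarrow> (f has_real_derivative f' x) (at x within {c..d})"
    and "negligible N" and "\<And>x. x \<in> {c..d} - N \<Longrightarrow> \<bar>f' x\<bar> \<le> C"
    and "0 \<le> C" and "x \<in> {c..d}" and "y \<in> {c..d}"
  shows "\<bar>f y - f x\<bar> \<le> C * \<bar>y - x\<bar>"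
proof -
  have ordered: "\<bar>f v - f u\<bar> \<le> C * \<bar>v - u\<bar>" if "u \<in> {c..d}" "v \<in> {c..d}" "u \<le> v" for u v
  proof -
    have "(f' has_integral (f v - f u)) {u..v}"
    proof (rule fundamental_theorem_of_calculus[OF \<open>u \<le> v\<close>])
      fix t assume "t \<in> {u..v}"
      with that have "(f has_real_derivative f' t) (at t within {u..v})"
        by (intro DERIV_subset[OF assms(1)]) auto
      then show "(f has_vector_derivative f' t) (at t within {u..v})"
        by (simp add: has_real_derivative_iff_has_vector_derivative)
    qed
    \<comment> \<open>Setting \<open>f'\<close> to 0 on \<open>N\<close> keeps the integral and, as
      \<open>0 \<le> C\<close>, makes the bound hold at every point of the interval.\<close>
    then have "((\<lambda>t. if t \<in> N then 0 else f' t) has_integral (f v - f u)) {u..v}"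
      by (rule has_integral_spike[OF assms(2), rotated]) auto
    then have "norm (f v - f u) \<le> C * measure lborel {u..v}"
      using that assms(3,4) by (intro has_integral_bound_real[where S = "{}"]) auto
    with that show ?thesis by simp
  qed
  show ?thesis
  proof (cases "x \<le> y")
    case True
    with ordered assms(5,6) show ?thesis by blast
  next
    case False
    with ordered[OF assms(6,5)] show ?thesis by (simp add: abs_minus_commute)
  qed
qed

text \<open>The difference quotients at \<open>x\<close> are bounded by \<open>C\<close>, and the
  bound passes to their limit because \<open>x\<close> is not isolated in \<open>S\<close>.\<close>

lemma derivative_le_lipschitz_constant:
  fixes f :: "real \<Rightarrow> real"
  assumes "(f has_real_derivative D) (at x within S)" and "at x within S \<noteq> bot"
    and "\<And>y. y \<in> S \<Longrightarrow> \<bar>f y - f x\<bar> \<le> C * \<bar>y - x\<bar>"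
  shows "\<bar>D\<bar> \<le> C"
proof (rule tendsto_upperbound[OF _ _ assms(2)])
  show "((\<lambda>y. \<bar>(f y - f x) / (y - x)\<bar>) \<longlongrightarrow> \<bar>D\<bar>) (at x within S)"
    using assms(1) by (intro tendsto_rabs) (simp add: has_field_derivative_iff)
  show "\<forall>\<^sub>F y in at x within S. \<bar>(f y - f x) / (y - x)\<bar> \<le> C"
    using assms(3) by (auto simp: eventually_at_filter divide_simps)
qed

lemma bdd_above_derivative_of_L_infinity:
  fixes f f' :: "real \<Rightarrow> real"
  assumes "a < b"
    and deriv: "\<And>x. x \<in> {a..b} \<Longrightarrow> (f has_real_derivative f' x) (at x within {a..b})"
    and "L_infinity_on a b f'"
  shows "bdd_above ((\<lambda>t. \<bar>f' t\<bar>) ` {a..b})"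
proof -
  obtain C where "AE t in lebesgue_on {a..b}. \<bar>f' t\<bar> \<le> C"
    using assms(3) by (auto simp: L_infinity_on_def)
  then have "AE t in lebesgue. t \<in> {a..b} \<longrightarrow> \<bar>f' t\<bar> \<le> C"
    by (simp add: AE_restrict_space_iff)
  then obtain N where "N \<in> null_sets lebesgue" "{t. \<not> (t \<in> {a..b} \<longrightarrow> \<bar>f' t\<bar> \<le> C)} \<subseteq> N"
    by (auto simp: eventually_ae_filter)
  \<comment> \<open>The maximum with 0 supplies the nonnegative constant that the Lipschitz lemma
    asks for, with no argument about the sign of \<open>C\<close>.\<close>
  then have N: "negligible N" "\<And>t. t \<in> {a..b} - N \<Longrightarrow> \<bar>f' t\<bar> \<le> max 0 C"
    by (auto simp: negligible_iff_null_sets)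
  have "\<bar>f' x\<bar> \<le> max 0 C" if x: "x \<in> {a..b}" for x
  proof (rule derivative_le_lipschitz_constant[OF deriv[OF x]])
    show "at x within {a..b} \<noteq> bot"
      using x \<open>a < b\<close> by (simp add: trivial_limit_within islimpt_Icc)
  qed (use x N in \<open>auto intro!: lipschitz_of_derivative_bounded_off_negligible[OF deriv]\<close>)
  then show ?thesis by (intro bdd_aboveI2)
qed

text \<open>Both endpoints are allowed so that \<open>q = p\<close> serves as the right end of
  \<open>{a..p}\<close> and as the left end of \<open>{p..b}\<close>.\<close>

lemma abs_integral_deviation_from_endpoint_le:
  fixes f f' :: "real \<Rightarrow> real"
  assumes "c \<le> d" and q: "q = c \<or> q = d"
    and deriv: "\<And>x. x \<in> {c..d} \<Longrightarrow> (f has_real_derivative f' x) (at x within {c..d})"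
    and bdd: "bdd_above ((\<lambda>t. \<bar>f' t\<bar>) ` {c..d})"
  shows "\<bar>(d - c) * f q - integral {c..d} f\<bar> \<le> (d - c)\<^sup>2 / 2 * sup_norm_on c d f'"
proof -
  define K where "K = sup_norm_on c d f'"
  have K: "\<bar>f' t\<bar> \<le> K" if "t \<in> {c..d}" for t
    unfolding K_def sup_norm_on_def using that bdd by (rule cSUP_upper)
  have "0 \<le> K" using K[of c] \<open>c \<le> d\<close> by simp
  have lip: "\<bar>f q - f t\<bar> \<le> K * \<bar>q - t\<bar>" if "t \<in> {c..d}" for t
    using that q \<open>c \<le> d\<close> K \<open>0 \<le> K\<close>
    by (intro lipschitz_of_derivative_bounded_off_negligible[OF deriv, where N = "{}"]) auto
  have f: "f integrable_on {c..d}"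
    using deriv by (intro integrable_continuous_real DERIV_continuous_on)
  have wt: "((\<lambda>t. K * \<bar>q - t\<bar>) has_integral (d - c)\<^sup>2 / 2 * K) {c..d}"
  proof -
    \<comment> \<open>On the whole interval \<open>t - q\<close> has the constant sign
      \<open>s\<close>; removing the absolute value this way gives the antiderivative
      \<open>K * s * (t - q)\<^sup>2 / 2\<close>.\<close>
    define s :: real where "s = (if q = c then 1 else -1)"
    have s: "\<bar>q - t\<bar> = s * (t - q)" if "t \<in> {c..d}" for t
      using that q by (auto simp: s_def)
    have "((\<lambda>t. K * (s * (t - q))) has_integral
        K * s * (d - q)\<^sup>2 / 2 - K * s * (c - q)\<^sup>2 / 2) {c..d}"
      using \<open>c \<le> d\<close>
      by (intro fundamental_theorem_of_calculus)
         (auto intro!: derivative_eq_intros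
           simp: has_real_derivative_iff_has_vector_derivative[symmetric])
    also have "K * s * (d - q)\<^sup>2 / 2 - K * s * (c - q)\<^sup>2 / 2 = (d - c)\<^sup>2 / 2 * K"
      using q by (auto simp: s_def power2_commute)
    finally show ?thesis
      by (rule has_integral_eq[rotated]) (simp add: s)
  qed
  have "integral {c..d} (\<lambda>t. f q - f t) = (d - c) * f q - integral {c..d} f"
    using f \<open>c \<le> d\<close> by (subst integral_diff) auto
  moreover have "norm (integral {c..d} (\<lambda>t. f q - f t)) \<le> integral {c..d} (\<lambda>t. K * \<bar>q - t\<bar>)"
    using f wt lip by (intro integral_norm_bound_integral integrable_diff) auto
  ultimately show ?thesis
    unfolding integral_unique[OF wt] by (simp only: K_def real_norm_def)
qed

lemma sup_norm_on_mono:
  assumes "bdd_above ((\<lambda>t. \<bar>g t\<bar>) ` {a..b})" "a \<le> c" "c \<le> d" "d \<le> b"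
  shows "sup_norm_on c d g \<le> sup_norm_on a b g"
  unfolding sup_norm_on_def using assms by (intro cSUP_subset_mono) auto

theorem theorem1p4:
  fixes a b :: real and f f' :: "real \<Rightarrow> real"
  assumes "a < b"
    and "\<And>x. x \<in> {a..b} \<Longrightarrow> (f has_real_derivative f' x) (at x within {a..b})"
    and "L_infinity_on a b f'"
  shows "\<forall>p\<in>{a<..<b}.
    \<bar>f p - 1 / (b - a) * integral {a..b} f\<bar> \<le>
      min ((1/4 + ((p - (a + b) / 2) / (b - a))\<^sup>2) * (b - a) * sup_norm_on a b f')
          (1/2 * max ((p - a) * sup_norm_on a p f') ((b - p) * sup_norm_on p b f'))"
proof
  fix p assume "p \<in> {a<..<b}"
  then have p: "a < p" "p < b" by auto
  define A B M where "A = sup_norm_on a p f'" and "B = sup_norm_on p b f'"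
    and "M = sup_norm_on a b f'"
  define m where "m = max ((p - a) * A) ((b - p) * B)"
  note bdd = bdd_above_derivative_of_L_infinity[OF assms]
  have bdd_sub: "bdd_above ((\<lambda>t. \<bar>f' t\<bar>) ` {c..d})" if "a \<le> c" "d \<le> b" for c d
    using that by (intro bdd_above_mono[OF bdd]) auto
  have deriv_sub: "(f has_real_derivative f' x) (at x within {c..d})"
    if "a \<le> c" "d \<le> b" "x \<in> {c..d}" for c d x
    using that by (intro DERIV_subset[OF assms(2)]) auto
  have AM: "A \<le> M" and BM: "B \<le> M"
    using p by (auto simp: A_def B_def M_def intro!: sup_norm_on_mono bdd)
  have "f integrable_on {a..b}"
    using assms(2) by (intro integrable_continuous_real DERIV_continuous_on)
  then have split: "integral {a..b} f = integral {a..p} f + integral {p..b} f"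
    using p by (intro Henstock_Kurzweil_Integration.integral_combine[symmetric]) auto
  have "\<bar>(p - a) * f p - integral {a..p} f\<bar> \<le> (p - a)\<^sup>2 / 2 * A"
    "\<bar>(b - p) * f p - integral {p..b} f\<bar> \<le> (b - p)\<^sup>2 / 2 * B"
    unfolding A_def B_def using p
    by (intro abs_integral_deviation_from_endpoint_le deriv_sub bdd_sub; simp)+
  moreover have "(b - a) * f p - integral {a..b} f =
      ((p - a) * f p - integral {a..p} f) + ((b - p) * f p - integral {p..b} f)"
    by (simp add: split algebra_simps)
  ultimately have "\<bar>(b - a) * f p - integral {a..b} f\<bar> \<le> (p - a)\<^sup>2 / 2 * A + (b - p)\<^sup>2 / 2 * B"
    by linarith
  moreover have "f p - 1 / (b - a) * integral {a..b} f =
      ((b - a) * f p - integral {a..b} f) / (b - a)"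
    using assms(1) by (simp add: field_simps)
  ultimately have main: "\<bar>f p - 1 / (b - a) * integral {a..b} f\<bar> \<le>
      ((p - a)\<^sup>2 / 2 * A + (b - p)\<^sup>2 / 2 * B) / (b - a)"
    using assms(1) by (simp add: divide_right_mono)
  have "((p - a)\<^sup>2 / 2 * A + (b - p)\<^sup>2 / 2 * B) / (b - a) \<le>
      ((p - a)\<^sup>2 / 2 * M + (b - p)\<^sup>2 / 2 * M) / (b - a)"
    using assms(1) AM BM by (intro divide_right_mono add_mono mult_left_mono) auto
  also have "\<dots> = (1/4 + ((p - (a + b) / 2) / (b - a))\<^sup>2) * (b - a) * M"
  proof -
    \<comment> \<open>With \<open>u = p - (a + b) / 2\<close>, the identity rests on \<open>(p -
      a)\<^sup>2 + (b - p)\<^sup>2 = 2 * u\<^sup>2 + h\<^sup>2 / 2\<close>. Writing \<open>b\<close>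
      as \<open>a + h\<close> turns the denominator into a single nonzero variable.\<close>
    define h where "h = b - a"
    have h: "h \<noteq> 0" "b = a + h" using assms(1) by (auto simp: h_def)
    show ?thesis
      using h(1) unfolding h(2) by (simp add: field_simps power2_eq_square)
  qed
  finally have first: "((p - a)\<^sup>2 / 2 * A + (b - p)\<^sup>2 / 2 * B) / (b - a) \<le> \<dots>" .
  \<comment> \<open>The left side is twice the numerator, and the weights on the right sum to
    \<open>b - a\<close>, which cancels the denominator.\<close>
  have "(p - a) * ((p - a) * A) + (b - p) * ((b - p) * B) \<le> (p - a) * m + (b - p) * m"
    using p by (intro add_mono mult_left_mono) (auto simp: m_def)
  then have second: "((p - a)\<^sup>2 / 2 * A + (b - p)\<^sup>2 / 2 * B) / (b - a) \<le> 1/2 * m"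
    using assms(1) by (simp add: field_simps power2_eq_square)
  show "\<bar>f p - 1 / (b - a) * integral {a..b} f\<bar> \<le>
      min ((1/4 + ((p - (a + b) / 2) / (b - a))\<^sup>2) * (b - a) * sup_norm_on a b f')
          (1/2 * max ((p - a) * sup_norm_on a p f') ((b - p) * sup_norm_on p b f'))"
    using order_trans[OF main first] order_trans[OF main second]
    unfolding m_def A_def B_def M_def by (rule min.boundedI)
qed

end
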